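(* Let $n\ge 2$, let $(X_i,d_i)$ $(i=1,\ldots,n)$ be nonempty metric spaces, let $M:=X_1\times\cdots\times X_n$, and let $\psi\in\mathbf{\Psi}_n$. Then $(X_i,d_i)$ is a geodesic space for every $i=1,\ldots,n$ if and only if $(M,d_\psi)$ is a geodesic space.
   Context: For $n\ge 2$, let $\Omega_n:=\{(t_1,\ldots,t_n)\in\mathbb{R}^n \mid t_i\ge 0,\ \sum_{i=1}^n t_i=1\}$. The class $\mathbf{\Psi}_n$ consists of all continuous convex functions $\psi:\Omega_n\to\mathbb{R}$ such that $\psi(\mathbf{e}_1)=\cdots=\psi(\mathbf{e}_n)=1$, where $\mathbf{e}_1,\ldots,\mathbf{e}_n$ are the standard basis vectors of $\mathbb{R}^n$, and $$\psi(t_1,\ldots,t_n)\ge (1-t_i)\cdot\psi\left(\frac{t_1}{1-t_i},\ldots,\frac{t_{i-1}}{1-t_i},0,\frac{t_{i+1}}{1-t_i},\ldots,\frac{t_n}{1-t_i}\right)$$ for every $i=1,\ldots,n$ and all $(t_1,\ldots,t_n)\in\Omega_n$ with $t_i<1$. For metric spaces $(X_i,d_i)$ and $\psi\in\mathbf{\Psi}_n$, the metric $d_\psi$ on $M=X_1\times\cdots\times X_n$ is defined by $d_\psi(x,y):=0$ if $x=y$ and, for $x=(x_1,\ldots,x_n)\ne y=(y_1,\ldots,y_n)$, with $D:=\sum_{i=1}^n d_i(x_i,y_i)$, $$d_\psi(x,y):=D\cdot\psi\left(\frac{d_1(x_1,y_1)}{D},\ldots,\frac{d_n(x_n,y_n)}{D}\right).$$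 A metric space $(X,d)$ is a geodesic space if for any $x,y\in X$ there exists a continuous map $\gamma:[0,d(x,y)]\to X$ such that $\gamma(0)=x$, $\gamma(d(x,y))=y$, and $d(\gamma(t),\gamma(t'))=|t-t'|$ for all $t,t'\in[0,d(x,y)]$. *)

theory Defs
  imports "HOL-Analysis.Analysis"
begin

definition Omega :: "(real ^ 'n) set" where
  "Omega = {t. (\<forall>i. 0 \<le> t $ i) \<and> (\<Sum>i\<in>UNIV. t $ i) = 1}"

text \<open>
  Members of \<open>Psi\<close> are total functions on \<open>real ^ 'n\<close>, but only their values on the
  simplex \<open>Omega\<close> are constrained (and only these enter \<open>d_psi\<close> below).
\<close>

definition Psi :: "(real ^ 'n \<Rightarrow> real) set" where
  "Psi = {\<psi>. continuous_on Omega \<psi> \<and> convex_on Omega \<psi> \<and>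
              (\<forall>i. \<psi> (axis i 1) = 1) \<and>
              (\<forall>i. \<forall>t\<in>Omega. t $ i < 1 \<longrightarrow>
                 \<psi> t \<ge> (1 - t $ i) * \<psi> (\<chi> j. if j = i then 0 else t $ j / (1 - t $ i)))}"

definition d_psi ::
  "(real ^ 'n \<Rightarrow> real) \<Rightarrow> ('n \<Rightarrow> 'a \<Rightarrow> 'a \<Rightarrow> real) \<Rightarrow> ('n \<Rightarrow> 'a) \<Rightarrow> ('n \<Rightarrow> 'a) \<Rightarrow> real" where
  "d_psi \<psi> d x y =
     (if x = y then 0
      else let D = (\<Sum>i\<in>UNIV. d i (x i) (y i)) in D * \<psi> (\<chi> i. d i (x i) (y i) / D))"

definition geodesic_space :: "'a set \<Rightarrow> ('a \<Rightarrow> 'a \<Rightarrow> real) \<Rightarrow> bool" where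
  "geodesic_space X d \<longleftrightarrow>
     Metric_space X d \<and>
     (\<forall>x\<in>X. \<forall>y\<in>X. \<exists>\<gamma>.
        continuous_map (top_of_set {0..d x y}) (Metric_space.mtopology X d) \<gamma> \<and>
        \<gamma> 0 = x \<and> \<gamma> (d x y) = y \<and>
        (\<forall>t\<in>{0..d x y}. \<forall>t'\<in>{0..d x y}. d (\<gamma> t) (\<gamma> t') = \<bar>t - t'\<bar>))"

end

theory Submission
  imports Defs
begin

text \<open>
  The function \<open>\<psi>\<close> is the restriction to the simplex of a positively homogeneous function
  \<open>N\<close> on the nonnegative orthant (\<open>hom_ext\<close> below), and \<open>d_psi\<close> is \<open>N\<close> applied to the vector
  of coordinate distances.  Convexity of \<open>\<psi>\<close> makes \<open>N\<close> subadditive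
  (\<open>hom_ext_subadditive\<close>); the defining inequality of \<open>Psi\<close> says that replacing a coordinate
  by zero does not increase \<open>N\<close> (\<open>hom_ext_zero_coordinate_le\<close>).  Together they make \<open>N\<close>
  monotone (\<open>hom_ext_mono\<close>), whence the triangle inequality for \<open>d_psi\<close>, and, since
  \<open>N\<close> is normalised on the axes, \<open>v $ i \<le> N v\<close>.

  If all factors are geodesic, running through the coordinate geodesics simultaneously, each at
  speed proportional to its length, gives a geodesic of the product, by homogeneity.
  Conversely, let two points of the product differ only in coordinate \<open>i\<close>.  Their distance is
  that of their \<open>i\<close>-th coordinates.  Since \<open>v $ i \<le> N v\<close>, projecting a geodesic between them to
  coordinate \<open>i\<close> gives a path that is 1-Lipschitz and whose endpoints are as far apart as its
  parameter interval is long.  Such a path is a geodesic (\<open>isometric_if_nonexpanding\<close>), however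
  the other coordinates move meanwhile.
\<close>

section \<open>The homogeneous extension\<close>

definition hom_ext :: "(real ^ 'n \<Rightarrow> real) \<Rightarrow> real ^ 'n \<Rightarrow> real" where
  "hom_ext \<psi> v = (let s = \<Sum>i\<in>UNIV. v $ i in s * \<psi> (\<chi> i. v $ i / s))"

lemma hom_ext_0 [simp]: "hom_ext \<psi> 0 = 0"
  by (simp add: hom_ext_def)

lemma hom_ext_scaleR: "hom_ext \<psi> (c *\<^sub>R v) = c * hom_ext \<psi> v"
  by (cases "c = 0") (simp_all add: hom_ext_def sum_distrib_left [symmetric])

lemma hom_ext_axis:
  fixes \<psi> :: "real ^ 'n \<Rightarrow> real"
  assumes "\<psi> \<in> Psi"
  shows "hom_ext \<psi> (axis i c) = c"
proof -
  have "(\<Sum>j\<in>UNIV. (axis i 1 :: real ^ 'n) $ j) = 1"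
    by (simp add: axis_def)
  then have "hom_ext \<psi> (axis i 1) = 1"
    using assms by (simp add: hom_ext_def Psi_def)
  moreover have "axis i c = c *\<^sub>R (axis i 1 :: real ^ 'n)"
    by (simp add: vec_eq_iff axis_def)
  ultimately show ?thesis
    by (simp add: hom_ext_scaleR)
qed

lemma nonneg_vec_eq_0_iff:
  fixes v :: "real ^ 'n"
  assumes "\<And>i. 0 \<le> v $ i"
  shows "(\<Sum>i\<in>UNIV. v $ i) = 0 \<longleftrightarrow> v = 0"
  using assms by (simp add: sum_nonneg_eq_0_iff vec_eq_iff)

lemma normalised_in_Omega:
  fixes v :: "real ^ 'n"
  assumes "\<And>i. 0 \<le> v $ i" and "v \<noteq> 0"
  shows "(\<chi> i. v $ i / (\<Sum>j\<in>UNIV. v $ j)) \<in> Omega"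
  using assms nonneg_vec_eq_0_iff [of v]
  by (auto simp: Omega_def sum_nonneg simp flip: sum_divide_distrib)

text \<open>
  The normalisation of \<open>v + w\<close> is the convex combination of those of \<open>v\<close> and \<open>w\<close>, weighted by
  their coordinate sums, so this is convexity of \<open>\<psi>\<close>.
\<close>

lemma hom_ext_subadditive:
  fixes v w :: "real ^ 'n"
  assumes \<psi>: "\<psi> \<in> Psi" and v: "\<And>i. 0 \<le> v $ i" and w: "\<And>i. 0 \<le> w $ i"
  shows "hom_ext \<psi> (v + w) \<le> hom_ext \<psi> v + hom_ext \<psi> w"
proof (cases "v = 0 \<or> w = 0")
  case True
  then show ?thesis by auto
next
  case False
  define s where "s = (\<Sum>i\<in>UNIV. v $ i)"
  define t where "t = (\<Sum>i\<in>UNIV. w $ i)"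
  define p where "p = (\<chi> i. v $ i / s)"
  define q where "q = (\<chi> i. w $ i / t)"
  have "s \<noteq> 0" "t \<noteq> 0"
    using False nonneg_vec_eq_0_iff [OF v] nonneg_vec_eq_0_iff [OF w] by (auto simp: s_def t_def)
  moreover have "s \<ge> 0" "t \<ge> 0"
    unfolding s_def t_def using v w by (auto intro: sum_nonneg)
  ultimately have st: "s > 0" "t > 0" by auto
  have pq: "p \<in> Omega" "q \<in> Omega"
    unfolding p_def q_def s_def t_def using False v w by (auto intro: normalised_in_Omega)
  have eq: "(\<chi> i. (v + w) $ i / (s + t)) = (s / (s + t)) *\<^sub>R p + (t / (s + t)) *\<^sub>R q"
    using st by (simp add: vec_eq_iff p_def q_def add_divide_distrib)
  have "s / (s + t) + t / (s + t) = 1"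
    using st by (simp flip: add_divide_distrib)
  then have "\<psi> (\<chi> i. (v + w) $ i / (s + t)) \<le> s / (s + t) * \<psi> p + t / (s + t) * \<psi> q"
    unfolding eq using \<psi> st pq by (intro convex_on_def [THEN iffD1, THEN conjunct2, rule_format])
      (simp_all add: Psi_def)
  then have "(s + t) * \<psi> (\<chi> i. (v + w) $ i / (s + t))
      \<le> (s + t) * (s / (s + t) * \<psi> p + t / (s + t) * \<psi> q)"
    using st by (intro mult_left_mono) auto
  also have "\<dots> = s * \<psi> p + t * \<psi> q"
    using st by (simp add: distrib_left)
  finally show ?thesis
    by (simp add: hom_ext_def Let_def sum.distrib s_def t_def p_def q_def)
qed

lemma hom_ext_zero_coordinate_le:
  fixes v :: "real ^ 'n"
  assumes \<psi>: "\<psi> \<in> Psi" and v: "\<And>i. 0 \<le> v $ i"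
  shows "hom_ext \<psi> (\<chi> j. if j = k then 0 else v $ j) \<le> hom_ext \<psi> v"
proof -
  define s where "s = (\<Sum>i\<in>UNIV. v $ i)"
  define u where "u = (\<chi> j. if j = k then 0 else v $ j)"
  have u_nonneg: "0 \<le> u $ i" for i
    using v by (simp add: u_def)
  have "s = v $ k + (\<Sum>j\<in>UNIV - {k}. v $ j)"
    unfolding s_def by (rule sum.remove) auto
  moreover have "(\<Sum>j\<in>UNIV. u $ j) = (\<Sum>j\<in>UNIV - {k}. v $ j)"
    by (rule sum.mono_neutral_cong_right) (auto simp: u_def)
  ultimately have sum_u: "(\<Sum>j\<in>UNIV. u $ j) = s - v $ k"
    by simp
  have "hom_ext \<psi> u \<le> hom_ext \<psi> v"
  proof (cases "u = 0")
    case True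
    \<comment> \<open>Here \<open>v\<close> lies on an axis, where the inequality in \<open>Psi\<close> says nothing.\<close>
    then have "v = axis k (v $ k)"
      by (auto simp: vec_eq_iff u_def axis_def split: if_splits)
    then have "hom_ext \<psi> v = v $ k"
      using hom_ext_axis [OF \<psi>] by metis
    then show ?thesis
      using v True by simp
  next
    case False
    have "s - v $ k > 0"
      using False sum_u nonneg_vec_eq_0_iff [OF u_nonneg] sum_nonneg [of UNIV "\<lambda>j. u $ j"] u_nonneg
      by force
    moreover from this have s: "s > 0"
      using v [of k] by linarith
    ultimately have "v $ k / s < 1" by simp
    have "v \<noteq> 0"
      using s by (auto simp: s_def)
    then have "(\<chi> j. v $ j / s) \<in> Omega"
      unfolding s_def by (rule normalised_in_Omega [OF v])
    then have "(\<chi> j. v $ j / s) $ k < 1 \<longrightarrow>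
        (1 - (\<chi> j. v $ j / s) $ k) * \<psi> (\<chi> j. if j = k then 0
            else (\<chi> j. v $ j / s) $ j / (1 - (\<chi> j. v $ j / s) $ k)) \<le> \<psi> (\<chi> j. v $ j / s)"
      using \<psi> unfolding Psi_def by blast
    with \<open>v $ k / s < 1\<close> have "(1 - v $ k / s) * \<psi> (\<chi> j. if j = k then 0 else v $ j / s / (1 - v $ k / s))
        \<le> \<psi> (\<chi> j. v $ j / s)"
      by (simp only: vec_lambda_beta)
    moreover have "(\<chi> j. if j = k then 0 else v $ j / s / (1 - v $ k / s))
        = (\<chi> j. u $ j / (s - v $ k))"
      using s by (simp add: vec_eq_iff u_def right_diff_distrib)
    ultimately have "s * ((1 - v $ k / s) * \<psi> (\<chi> j. u $ j / (s - v $ k))) \<le> s * \<psi> (\<chi> j. v $ j / s)"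
      using s by (intro mult_left_mono) auto
    moreover have "s * ((1 - v $ k / s) * z) = (s - v $ k) * z" for z
      using s by (simp add: field_simps)
    ultimately show ?thesis
      by (simp add: hom_ext_def sum_u Let_def flip: s_def)
  qed
  then show ?thesis
    by (simp add: u_def)
qed

text \<open>
  Decreasing one coordinate yields a convex combination of the given vector and the one
  with that coordinate set to zero; on both of them \<open>hom_ext \<psi>\<close> is at most its original value.
\<close>

lemma hom_ext_decrease_coordinate_le:
  fixes v :: "real ^ 'n"
  assumes \<psi>: "\<psi> \<in> Psi" and v: "\<And>i. 0 \<le> v $ i" and c: "0 \<le> c" "c \<le> v $ k"
  shows "hom_ext \<psi> (\<chi> j. if j = k then c else v $ j) \<le> hom_ext \<psi> v"
proof (cases "v $ k = 0")
  case True
  then have "(\<chi> j. if j = k then c else v $ j) = v"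
    using c by (simp add: vec_eq_iff)
  then show ?thesis by simp
next
  case False
  then have pos: "v $ k > 0"
    using v [of k] by linarith
  define a where "a = c / v $ k"
  define u where "u = (\<chi> j. if j = k then 0 else v $ j)"
  have a: "0 \<le> a" "a \<le> 1"
    using c pos by (simp_all add: a_def)
  have "(\<chi> j. if j = k then c else v $ j) = a *\<^sub>R v + (1 - a) *\<^sub>R u"
    using pos by (auto simp: vec_eq_iff u_def a_def algebra_simps)
  then have "hom_ext \<psi> (\<chi> j. if j = k then c else v $ j)
      \<le> hom_ext \<psi> (a *\<^sub>R v) + hom_ext \<psi> ((1 - a) *\<^sub>R u)"
    using a v hom_ext_subadditive [OF \<psi>, of "a *\<^sub>R v" "(1 - a) *\<^sub>R u"] by (simp add: u_def)
  also have "\<dots> \<le> a * hom_ext \<psi> v + (1 - a) * hom_ext \<psi> v"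
    using a hom_ext_zero_coordinate_le [OF \<psi> v, of k]
    by (auto simp: hom_ext_scaleR u_def intro!: mult_left_mono)
  finally show ?thesis
    by (simp add: algebra_simps)
qed

lemma hom_ext_mono:
  fixes v w :: "real ^ 'n"
  assumes \<psi>: "\<psi> \<in> Psi" and v: "\<And>i. 0 \<le> v $ i" and le: "\<And>i. v $ i \<le> w $ i"
  shows "hom_ext \<psi> v \<le> hom_ext \<psi> w"
proof -
  \<comment> \<open>Lower the coordinates of \<open>w\<close> to those of \<open>v\<close> one after the other.\<close>
  have "hom_ext \<psi> (\<chi> i. if i \<in> A then v $ i else w $ i) \<le> hom_ext \<psi> w" if "finite A" for A
    using that
  proof (induction A)
    case empty
    then show ?case by simp
  next
    case (insert k A)
    let ?u = "\<chi> i. if i \<in> A then v $ i else w $ i"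
    have "(\<chi> i. if i \<in> insert k A then v $ i else w $ i) = (\<chi> j. if j = k then v $ k else ?u $ j)"
      by (auto simp: vec_eq_iff)
    moreover have "hom_ext \<psi> (\<chi> j. if j = k then v $ k else ?u $ j) \<le> hom_ext \<psi> ?u"
      using insert v le order_trans [OF v le]
      by (intro hom_ext_decrease_coordinate_le [OF \<psi>]) auto
    ultimately show ?case
      using insert by simp
  qed
  from this [of UNIV] show ?thesis by simp
qed

lemma coordinate_le_hom_ext:
  fixes v :: "real ^ 'n"
  assumes \<psi>: "\<psi> \<in> Psi" and v: "\<And>i. 0 \<le> v $ i"
  shows "v $ i \<le> hom_ext \<psi> v"
proof -
  have "hom_ext \<psi> (axis i (v $ i)) \<le> hom_ext \<psi> v"
    using v by (intro hom_ext_mono [OF \<psi>]) (auto simp: axis_def)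
  then show ?thesis
    by (simp add: hom_ext_axis [OF \<psi>])
qed

section \<open>The product metric\<close>

lemma d_psi_eq_hom_ext:
  assumes "\<And>i. Metric_space (X i) (d i)" and "x \<in> PiE UNIV X"
  shows "d_psi \<psi> d x y = hom_ext \<psi> (\<chi> i. d i (x i) (y i))"
proof (cases "x = y")
  case True
  have "d i (x i) (x i) = 0" for i
    using assms Metric_space.zero [of "X i" "d i" "x i" "x i"] by auto
  then show ?thesis
    using True by (simp add: d_psi_def hom_ext_def)
qed (simp add: d_psi_def hom_ext_def Let_def)

lemma coordinate_dist_le_d_psi:
  assumes "\<psi> \<in> Psi" and d: "\<And>i. Metric_space (X i) (d i)" and "x \<in> PiE UNIV X"
  shows "d i (x i) (y i) \<le> d_psi \<psi> d x y"
proof -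
  have "(\<chi> j. d j (x j) (y j)) $ i \<le> hom_ext \<psi> (\<chi> j. d j (x j) (y j))"
    using assms Metric_space.nonneg [OF d] by (intro coordinate_le_hom_ext) auto
  then show ?thesis
    using d_psi_eq_hom_ext [where d = d, OF d assms(3)] by simp
qed

lemma Metric_space_d_psi:
  assumes \<psi>: "\<psi> \<in> Psi" and d: "\<And>i. Metric_space (X i) (d i)"
  shows "Metric_space (PiE UNIV X) (d_psi \<psi> d)"
proof
  fix x y
  show "0 \<le> d_psi \<psi> d x y"
  proof (cases "x = y")
    case False
    have "0 \<le> (\<chi> i. d i (x i) (y i)) $ undefined"
      using Metric_space.nonneg [OF d] by simp
    also have "\<dots> \<le> hom_ext \<psi> (\<chi> i. d i (x i) (y i))"
      using Metric_space.nonneg [OF d] by (intro coordinate_le_hom_ext [OF \<psi>]) simp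
    finally show ?thesis
      using False by (simp add: d_psi_def hom_ext_def Let_def)
  qed (simp add: d_psi_def)
  show "d_psi \<psi> d x y = d_psi \<psi> d y x"
    using Metric_space.commute [OF d] by (simp add: d_psi_def)
next
  fix x y
  assume xy: "x \<in> PiE UNIV X" "y \<in> PiE UNIV X"
  show "d_psi \<psi> d x y = 0 \<longleftrightarrow> x = y"
  proof
    assume 0: "d_psi \<psi> d x y = 0"
    show "x = y"
    proof
      fix i
      have "d i (x i) (y i) = 0"
        using coordinate_dist_le_d_psi [where d = d, OF \<psi> d xy(1), of i y] 0
          Metric_space.nonneg [OF d, of i "x i" "y i"] by linarith
      then show "x i = y i"
        using xy Metric_space.zero [OF d] by (auto simp: PiE_iff)
    qed
  qed (simp add: d_psi_def)
next
  fix x y z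
  assume xyz: "x \<in> PiE UNIV X" "y \<in> PiE UNIV X" "z \<in> PiE UNIV X"
  let ?v = "\<lambda>x y. \<chi> i. d i (x i) (y i)"
  have "hom_ext \<psi> (?v x z) \<le> hom_ext \<psi> (?v x y + ?v y z)"
    using xyz Metric_space.nonneg [OF d] Metric_space.triangle [OF d]
    by (intro hom_ext_mono [OF \<psi>]) (auto simp: PiE_iff)
  also have "\<dots> \<le> hom_ext \<psi> (?v x y) + hom_ext \<psi> (?v y z)"
    using Metric_space.nonneg [OF d] by (intro hom_ext_subadditive [OF \<psi>]) auto
  finally show "d_psi \<psi> d x z \<le> d_psi \<psi> d x y + d_psi \<psi> d y z"
    using xyz by (simp add: d_psi_eq_hom_ext [where X = X, OF d])
qed

section \<open>Geodesics\<close>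

text \<open>
  An isometric map is continuous, so what is left of continuity is that \<open>\<gamma>\<close> takes its values
  in \<open>X\<close>.
\<close>

lemma geodesic_space_iff:
  "geodesic_space X d \<longleftrightarrow>
     Metric_space X d \<and>
     (\<forall>x\<in>X. \<forall>y\<in>X. \<exists>\<gamma>. \<gamma> ` {0..d x y} \<subseteq> X \<and> \<gamma> 0 = x \<and> \<gamma> (d x y) = y \<and>
        (\<forall>t\<in>{0..d x y}. \<forall>t'\<in>{0..d x y}. d (\<gamma> t) (\<gamma> t') = \<bar>t - t'\<bar>))"
proof -
  have "continuous_map (top_of_set {0..L}) (Metric_space.mtopology X d) \<gamma> \<longleftrightarrow> \<gamma> ` {0..L} \<subseteq> X"
    if d: "Metric_space X d" and iso: "\<forall>t\<in>{0..L}. \<forall>t'\<in>{0..L}. d (\<gamma> t) (\<gamma> t') = \<bar>t - t'\<bar>"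
    for L :: real and \<gamma>
  proof
    interpret Metric_space X d by (rule d)
    show "\<gamma> ` {0..L} \<subseteq> X" if "continuous_map (top_of_set {0..L}) mtopology \<gamma>"
      using continuous_map_image_subset_topspace [OF that] by simp
    show "continuous_map (top_of_set {0..L}) mtopology \<gamma>" if X: "\<gamma> ` {0..L} \<subseteq> X"
      unfolding continuous_map_to_metric
    proof (intro ballI allI impI)
      fix t \<epsilon> :: real
      assume t: "t \<in> topspace (top_of_set {0..L})" and "\<epsilon> > 0"
      have "openin (top_of_set {0..L}) ({0..L} \<inter> ball t \<epsilon>)"
        by (simp add: openin_open_Int)
      moreover have "\<forall>t'\<in>{0..L} \<inter> ball t \<epsilon>. \<gamma> t' \<in> mball (\<gamma> t) \<epsilon>"
        using t X iso by (auto simp: dist_real_def)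
      ultimately show "\<exists>U. openin (top_of_set {0..L}) U \<and> t \<in> U \<and> (\<forall>t'\<in>U. \<gamma> t' \<in> mball (\<gamma> t) \<epsilon>)"
        using t \<open>\<epsilon> > 0\<close> by (intro exI [of _ "{0..L} \<inter> ball t \<epsilon>"]) auto
    qed
  qed
  then show ?thesis
    unfolding geodesic_space_def
    by (intro conj_cong [OF refl] ball_cong [OF refl] ex_cong1) (meson atLeastAtMost_iff)
qed

text \<open>
  For \<open>t \<le> t'\<close>, the successive distances between the points at \<open>0\<close>, \<open>t\<close>, \<open>t'\<close>, \<open>L\<close> are at
  most \<open>t\<close>, \<open>t' - t\<close> and \<open>L - t'\<close>, with sum \<open>L\<close>, while the triangle inequality forces them
  to add up to at least \<open>L\<close>.  So none of the three bounds is strict.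
\<close>

lemma (in Metric_space) isometric_if_nonexpanding:
  fixes L :: real
  assumes img: "\<gamma> ` {0..L} \<subseteq> M"
    and le: "\<And>t t'. t \<in> {0..L} \<Longrightarrow> t' \<in> {0..L} \<Longrightarrow> d (\<gamma> t) (\<gamma> t') \<le> \<bar>t - t'\<bar>"
    and ends: "d (\<gamma> 0) (\<gamma> L) = L"
    and t: "t \<in> {0..L}" "t' \<in> {0..L}"
  shows "d (\<gamma> t) (\<gamma> t') = \<bar>t - t'\<bar>"
  using t
proof (induction t t' rule: linorder_wlog)
  case (le a b)
  have in_M: "\<gamma> 0 \<in> M" "\<gamma> a \<in> M" "\<gamma> b \<in> M" "\<gamma> L \<in> M"
    using le img by (auto simp: image_subset_iff)
  have "L \<le> d (\<gamma> 0) (\<gamma> a) + d (\<gamma> a) (\<gamma> L)"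
    using triangle [of "\<gamma> 0" "\<gamma> a" "\<gamma> L"] in_M ends by simp
  also have "d (\<gamma> a) (\<gamma> L) \<le> d (\<gamma> a) (\<gamma> b) + d (\<gamma> b) (\<gamma> L)"
    using in_M by (intro triangle)
  finally show ?case
    using le assms(2) [of 0 a] assms(2) [of a b] assms(2) [of b L] by auto
next
  case (sym a b)
  then show ?case
    by (simp add: commute abs_minus_commute)
qed

lemma geodesic_product:
  assumes \<psi>: "\<psi> \<in> Psi" and geo: "\<And>i. geodesic_space (X i) (d i)"
  shows "geodesic_space (PiE UNIV X) (d_psi \<psi> d)"
  unfolding geodesic_space_iff
proof (intro conjI ballI)
  have d: "\<And>i. Metric_space (X i) (d i)"
    using geo by (simp add: geodesic_space_iff)
  show M: "Metric_space (PiE UNIV X) (d_psi \<psi> d)"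
    by (rule Metric_space_d_psi [OF \<psi> d])
  fix x y
  assume xy: "x \<in> PiE UNIV X" "y \<in> PiE UNIV X"
  define L where "L = d_psi \<psi> d x y"
  define l where "l i = d i (x i) (y i)" for i
  have "\<forall>i. \<exists>\<gamma>. \<gamma> ` {0..l i} \<subseteq> X i \<and> \<gamma> 0 = x i \<and> \<gamma> (l i) = y i \<and>
        (\<forall>t\<in>{0..l i}. \<forall>t'\<in>{0..l i}. d i (\<gamma> t) (\<gamma> t') = \<bar>t - t'\<bar>)"
    using geo xy unfolding geodesic_space_iff l_def by (auto simp: PiE_iff)
  then obtain g where g: "g i ` {0..l i} \<subseteq> X i" "g i 0 = x i" "g i (l i) = y i"
      "\<And>t t'. t \<in> {0..l i} \<Longrightarrow> t' \<in> {0..l i} \<Longrightarrow> d i (g i t) (g i t') = \<bar>t - t'\<bar>" for i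
    by metis
  have l: "l i \<ge> 0" for i
    using Metric_space.nonneg [OF d] by (simp add: l_def)
  have L_hom: "L = hom_ext \<psi> (\<chi> i. l i)"
    unfolding L_def l_def using d xy(1) by (rule d_psi_eq_hom_ext)
  have "L \<ge> 0"
    unfolding L_def using Metric_space.nonneg [OF M] .
  show "\<exists>\<gamma>. \<gamma> ` {0..d_psi \<psi> d x y} \<subseteq> PiE UNIV X \<and> \<gamma> 0 = x \<and> \<gamma> (d_psi \<psi> d x y) = y \<and>
      (\<forall>t\<in>{0..d_psi \<psi> d x y}. \<forall>t'\<in>{0..d_psi \<psi> d x y}.
        d_psi \<psi> d (\<gamma> t) (\<gamma> t') = \<bar>t - t'\<bar>)"
    unfolding L_def [symmetric]
  proof (cases "L = 0")
    case True
    then have "x = y"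
      using xy Metric_space.zero [OF M] by (simp add: L_def)
    then show "\<exists>\<gamma>. \<gamma> ` {0..L} \<subseteq> PiE UNIV X \<and> \<gamma> 0 = x \<and> \<gamma> L = y \<and>
        (\<forall>t\<in>{0..L}. \<forall>t'\<in>{0..L}. d_psi \<psi> d (\<gamma> t) (\<gamma> t') = \<bar>t - t'\<bar>)"
      using True xy by (intro exI [of _ "\<lambda>_. x"]) (auto simp: d_psi_def)
  next
    case False
    then have L: "L > 0"
      using \<open>L \<ge> 0\<close> by simp
    define \<gamma> where "\<gamma> t = (\<lambda>i. g i (t / L * l i))" for t
    have in_range: "t / L * l i \<in> {0..l i}" if "t \<in> {0..L}" for t i
      using that L l [of i] mult_right_mono [of "t / L" 1 "l i"] by simp
    then have img: "\<gamma> t \<in> PiE UNIV X" if "t \<in> {0..L}" for t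
      using g(1) in_range [OF that] by (simp add: \<gamma>_def PiE_iff image_subset_iff)
    have "d_psi \<psi> d (\<gamma> t) (\<gamma> t') = \<bar>t - t'\<bar>" if t: "t \<in> {0..L}" "t' \<in> {0..L}" for t t'
    proof -
      have "d i (\<gamma> t i) (\<gamma> t' i) = \<bar>t - t'\<bar> / L * l i" for i
      proof -
        have "d i (\<gamma> t i) (\<gamma> t' i) = \<bar>t / L * l i - t' / L * l i\<bar>"
          unfolding \<gamma>_def using t by (intro g(4) in_range)
        also have "t / L * l i - t' / L * l i = (t - t') / L * l i"
          by (simp add: diff_divide_distrib left_diff_distrib)
        finally show ?thesis
          using L l [of i] by (simp add: abs_mult)
      qed
      then have "(\<chi> i. d i (\<gamma> t i) (\<gamma> t' i)) = (\<bar>t - t'\<bar> / L) *\<^sub>R (\<chi> i. l i)"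
        by (simp add: vec_eq_iff)
      then have "d_psi \<psi> d (\<gamma> t) (\<gamma> t') = \<bar>t - t'\<bar> / L * L"
        using d_psi_eq_hom_ext [where d = d, OF d img [OF t(1)]] by (simp add: hom_ext_scaleR L_hom)
      then show ?thesis
        using L by simp
    qed
    then show "\<exists>\<gamma>. \<gamma> ` {0..L} \<subseteq> PiE UNIV X \<and> \<gamma> 0 = x \<and> \<gamma> L = y \<and>
        (\<forall>t\<in>{0..L}. \<forall>t'\<in>{0..L}. d_psi \<psi> d (\<gamma> t) (\<gamma> t') = \<bar>t - t'\<bar>)"
      using img L by (intro exI [of _ \<gamma>] conjI ballI image_subsetI) (simp_all add: \<gamma>_def g(2,3))
  qed
qed

lemma geodesic_factor:
  assumes \<psi>: "\<psi> \<in> Psi" and d: "\<And>i. Metric_space (X i) (d i)" and ne: "\<And>i. X i \<noteq> {}"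
    and geo: "geodesic_space (PiE UNIV X) (d_psi \<psi> d)"
  shows "geodesic_space (X k) (d k)"
  unfolding geodesic_space_iff
proof (intro conjI ballI)
  show "Metric_space (X k) (d k)" by (rule d)
  fix a b
  assume ab: "a \<in> X k" "b \<in> X k"
  obtain p where p: "\<And>i. p i \<in> X i"
    using that [of "\<lambda>i. SOME a. a \<in> X i"] ne by (simp add: some_in_eq)
  define x where "x = p(k := a)"
  define y where "y = p(k := b)"
  define L where "L = d k a b"
  have xy: "x \<in> PiE UNIV X" "y \<in> PiE UNIV X"
    using p ab by (auto simp: x_def y_def)
  have "d i (p i) (p i) = 0" for i
    using p Metric_space.zero [OF d] by auto
  then have "(\<chi> i. d i (x i) (y i)) = axis k L"
    by (auto simp: vec_eq_iff axis_def x_def y_def L_def)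
  then have "d_psi \<psi> d x y = L"
    using d_psi_eq_hom_ext [where d = d, OF d xy(1)] hom_ext_axis [OF \<psi>] by simp
  then obtain \<gamma> where \<gamma>: "\<gamma> ` {0..L} \<subseteq> PiE UNIV X" "\<gamma> 0 = x" "\<gamma> L = y"
      "\<And>t t'. t \<in> {0..L} \<Longrightarrow> t' \<in> {0..L} \<Longrightarrow> d_psi \<psi> d (\<gamma> t) (\<gamma> t') = \<bar>t - t'\<bar>"
    using geo xy unfolding geodesic_space_iff by metis
  have img: "(\<lambda>t. \<gamma> t k) ` {0..L} \<subseteq> X k"
    using \<gamma>(1) by (auto simp: PiE_iff subset_iff)
  have le: "d k (\<gamma> t k) (\<gamma> t' k) \<le> \<bar>t - t'\<bar>" if "t \<in> {0..L}" "t' \<in> {0..L}" for t t'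
    using coordinate_dist_le_d_psi [where d = d, OF \<psi> d, of "\<gamma> t" k "\<gamma> t'"] that \<gamma>(1) \<gamma>(4)
    by (metis image_subset_iff)
  have ends: "\<gamma> 0 k = a" "\<gamma> L k = b"
    using \<gamma> by (auto simp: x_def y_def)
  have "d k (\<gamma> t k) (\<gamma> t' k) = \<bar>t - t'\<bar>" if "t \<in> {0..L}" "t' \<in> {0..L}" for t t'
    using Metric_space.isometric_if_nonexpanding [OF d, of "\<lambda>t. \<gamma> t k" L k t t'] img le ends that
    by (simp add: L_def)
  then show "\<exists>\<gamma>. \<gamma> ` {0..d k a b} \<subseteq> X k \<and> \<gamma> 0 = a \<and> \<gamma> (d k a b) = b \<and>
      (\<forall>t\<in>{0..d k a b}. \<forall>t'\<in>{0..d k a b}. d k (\<gamma> t) (\<gamma> t') = \<bar>t - t'\<bar>)"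
    unfolding L_def [symmetric] using img ends by (intro exI [of _ "\<lambda>t. \<gamma> t k"]) auto
qed

theorem theorem7p5:
  fixes X :: "'n::finite \<Rightarrow> 'a set"
    and d :: "'n \<Rightarrow> 'a \<Rightarrow> 'a \<Rightarrow> real"
    and \<psi> :: "real ^ 'n \<Rightarrow> real"
  assumes "2 \<le> CARD('n)"
    and "\<And>i. Metric_space (X i) (d i)"
    and "\<And>i. X i \<noteq> {}"
    and "\<psi> \<in> Psi"
  shows "(\<forall>i. geodesic_space (X i) (d i)) \<longleftrightarrow> geodesic_space (PiE UNIV X) (d_psi \<psi> d)"
  using geodesic_product [OF assms(4), of X d] geodesic_factor [where X = X and d = d, OF assms(4,2,3)]
  by blast

end
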